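(* Let $K$ be a field complete with respect to a discrete non-archimedean valuation $v$, with uniformizer $\pi$ and residue field $k$. Let $F=(f_1,\ldots,f_n)$ be a system of $n$ nonzero polynomials in $K[X_1^{\pm1},\ldots,X_n^{\pm1}]$. Let $w\in v(\pi)\mathbb{Z}^n$ be an isolated point of $\mathrm{Trop}(F)$. If the initial form system $\mathrm{in}_w(F)$ has no degenerate zeros in $(k^\ast)^n$, then the first digit map $\delta$ induces a bijection between the set of zeros of $F$ in $(K^\ast)^n$ with valuation vector $w$ and the set of zeros of $\mathrm{in}_w(F)$ in $(k^\ast)^n$.
   Context: Let $v:K\to\mathbb{R}\cup\{\infty\}$ be the discrete (nontrivial) valuation, $A=\{x: v(x)\ge 0\}$ the valuation ring, $\mathfrak{M}=\{x:v(x)>0\}=\pi A$ its maximal ideal with a fixed generator $\pi$, and $k=A/\mathfrak{M}$. The first digit of $x\in K^\ast$ is $\delta(x)=\pi^{-v(x)/v(\pi)}x \bmod \mathfrak{M}\in k^\ast$; $v$ and $\delta$ are applied componentwise to vectors in $(K^\ast)^n$. For a nonzero $f=\sum_{i=1}^t a_iX^{\alpha_i}\in K[X_1^{\pm1},\ldots,X_n^{\pm1}]$ (with $a_i\in K^\ast$ and distinct $\alpha_i\in\mathbb{Z}^n$) and $w\in\mathbb{R}^n$, put $l_i(f;w)=v(a_i)+\alpha_i\cdot w$ and $\mathrm{tr}(f;w)=\min_i l_i(f;w)$. The set $\mathrm{Trop}(f)\subseteq\mathbb{R}^n$ consists of the points where $\mathrm{tr}(f;\cdot)$ is not differentiable (equivalently,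 where the minimum is attained by at least two indices $i$). The initial form is $\mathrm{in}_w(f)=\sum_{i:\,l_i(f;w)=\mathrm{tr}(f;w)}\delta(a_i)X^{\alpha_i}\in k[X_1^{\pm1},\ldots,X_n^{\pm1}]$. For a system $F=(f_1,\ldots,f_n)$: $\mathrm{Trop}(F)=\bigcap_i\mathrm{Trop}(f_i)$ and $\mathrm{in}_w(F)=(\mathrm{in}_w(f_1),\ldots,\mathrm{in}_w(f_n))$. A zero of a square system is degenerate if the Jacobian determinant of the system vanishes at it. *)

theory Defs
  imports "HOL-Analysis.Analysis" "HOL-Library.Poly_Mapping"
begin

section \<open>Valued fields\<close>

class valued_field = field +
  fixes val :: "'a \<Rightarrow> ereal"
  assumes val_not_MInf: "val x \<noteq> -\<infinity>"
    and val_eq_PInf_iff: "val x = \<infinity> \<longleftrightarrow> x = 0"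
    and val_mult: "val (x * y) = val x + val y"
    and val_add: "min (val x) (val y) \<le> val (x + y)"

text \<open>
  The valuation is discrete and nontrivial: the value group is \<open>c \<cdot> \<int>\<close> for some real \<open>c > 0\<close>,
  which need not be \<open>1\<close>.
  Completeness is stated directly in terms of \<open>val\<close> and agrees with completeness for any of the
  metrics \<open>b powr (- val (x - y))\<close> with \<open>b > 1\<close>.
\<close>

class complete_discrete_valued_field = valued_field +
  assumes val_discrete:
    "\<exists>c::real. c > 0 \<and> val ` (UNIV - {0}) = range (\<lambda>m::int. ereal (c * of_int m))"
    and val_complete:
    "(\<forall>C::real. \<exists>N::nat. \<forall>p\<ge>N. \<forall>q\<ge>N. ereal C \<le> val (X p - X q)) \<Longrightarrow>
       \<exists>L. \<forall>C::real. \<exists>N::nat. \<forall>p\<ge>N. ereal C \<le> val (X p - L)"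

definition valuation_ring :: "'a::valued_field set"
  where "valuation_ring = {x. val x \<ge> 0}"

definition maximal_ideal :: "'a::valued_field set"
  where "maximal_ideal = {x. val x > 0}"

definition uniformizer :: "'a::valued_field \<Rightarrow> bool"
  where "uniformizer \<pi> \<longleftrightarrow> maximal_ideal = (\<lambda>a. \<pi> * a) ` valuation_ring"

text \<open>Only meaningful for \<open>x \<noteq> 0\<close>; the conversion sends \<open>\<infinity>\<close> to \<open>0\<close>.\<close>

definition rval :: "'a::valued_field \<Rightarrow> real"
  where "rval x = real_of_ereal (val x)"

lemma val_zero [simp]: "val (0::'a::valued_field) = \<infinity>"
  by (simp add: val_eq_PInf_iff)

lemma val_rval: "x \<noteq> 0 \<Longrightarrow> val x = ereal (rval x)" for x :: "'a::valued_field"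
  using val_not_MInf[of x] val_eq_PInf_iff[of x] by (cases "val x") (auto simp: rval_def)

lemma val_one [simp]: "val (1::'a::valued_field) = 0"
  using val_mult[of "1::'a" 1] val_rval[of "1::'a"] by (auto simp: zero_ereal_def)

lemma val_uminus [simp]: "val (- x) = val x" for x :: "'a::valued_field"
proof -
  have "val (-1::'a) = 0"
    using val_mult[of "-1::'a" "-1"] val_rval[of "-1::'a"] by (auto simp: zero_ereal_def)
  then show ?thesis
    using val_mult[of "-1" x] by simp
qed

lemma val_inverse: "x \<noteq> 0 \<Longrightarrow> val (inverse x) = ereal (- rval x)" for x :: "'a::valued_field"
  using val_mult[of x "inverse x"] val_rval[of x] val_rval[of "inverse x"]
  by (auto simp: zero_ereal_def)

lemma val_add_ge: "c \<le> val x \<Longrightarrow> c \<le> val y \<Longrightarrow> c \<le> val (x + y)" for x y :: "'a::valued_field"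
  using val_add[of x y] by (meson min.boundedI order_trans)

lemma val_diff_ge: "c \<le> val x \<Longrightarrow> c \<le> val y \<Longrightarrow> c \<le> val (x - y)" for x y :: "'a::valued_field"
  using val_add_ge[of c x "- y"] by simp

lemma val_add_gt: "c < val x \<Longrightarrow> c < val y \<Longrightarrow> c < val (x + y)" for x y :: "'a::valued_field"
  using val_add[of x y] by (meson min_less_iff_conj less_le_trans)

lemma val_mult_ge0: "0 \<le> val x \<Longrightarrow> 0 \<le> val y \<Longrightarrow> 0 \<le> val (x * y)" for x y :: "'a::valued_field"
  by (simp add: val_mult)

lemma val_mult_gt0: "0 < val x \<Longrightarrow> 0 \<le> val y \<Longrightarrow> 0 < val (x * y)" for x y :: "'a::valued_field"
  by (simp add: val_mult add_pos_nonneg)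


section \<open>The residue field\<close>

text \<open>
  The quotient of the valuation ring by its maximal ideal. The relation is a partial equivalence
  whose domain is the valuation ring.
\<close>

definition residue_rel :: "'a::valued_field \<Rightarrow> 'a \<Rightarrow> bool"
  where "residue_rel x y \<longleftrightarrow>
    x \<in> valuation_ring \<and> y \<in> valuation_ring \<and> x - y \<in> maximal_ideal"

lemma residue_rel_refl: "residue_rel x x \<longleftrightarrow> 0 \<le> val x"
  by (simp add: residue_rel_def valuation_ring_def maximal_ideal_def)

lemma residue_rel_sym: "residue_rel x y \<Longrightarrow> residue_rel y x"
  unfolding residue_rel_def maximal_ideal_def
  by (metis mem_Collect_eq minus_diff_eq val_uminus)

lemma residue_rel_trans: "residue_rel x y \<Longrightarrow> residue_rel y z \<Longrightarrow> residue_rel x z"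
  unfolding residue_rel_def maximal_ideal_def
  using val_add_gt[of 0 "x - y" "y - z"] by simp

quotient_type (overloaded) 'a residue = "'a::valued_field" / partial: residue_rel
proof (rule part_equivpI)
  show "\<exists>x::'a. residue_rel x x"
    by (rule exI[of _ 0]) (simp add: residue_rel_refl)
qed (auto intro!: sympI transpI intro: residue_rel_sym residue_rel_trans)

lemma residue_rel_mult:
  assumes "residue_rel x x'" "residue_rel y y'"
  shows "residue_rel (x * y) (x' * y')"
proof -
  have eq: "x * y - x' * y' = (x - x') * y + (y - y') * x'"
    by (simp add: algebra_simps)
  have "0 < val ((x - x') * y)" "0 < val ((y - y') * x')"
    using assms by (auto simp: residue_rel_def valuation_ring_def maximal_ideal_def
        intro!: val_mult_gt0)
  then have "0 < val (x * y - x' * y')"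
    unfolding eq by (rule val_add_gt)
  then show ?thesis
    using assms by (auto simp: residue_rel_def valuation_ring_def maximal_ideal_def val_mult_ge0)
qed

lemma residue_rel_add:
  assumes "residue_rel x x'" "residue_rel y y'"
  shows "residue_rel (x + y) (x' + y')"
proof -
  have eq: "x + y - (x' + y') = (x - x') + (y - y')"
    by (simp add: algebra_simps)
  have "0 < val (x + y - (x' + y'))"
    unfolding eq using assms
    by (intro val_add_gt) (auto simp: residue_rel_def maximal_ideal_def)
  then show ?thesis
    using assms by (auto simp: residue_rel_def valuation_ring_def maximal_ideal_def val_add_ge)
qed

lemma residue_rel_uminus:
  assumes "residue_rel x x'"
  shows "residue_rel (- x) (- x')"
proof -
  have eq: "- x - (- x') = - (x - x')"
    by simp
  show ?thesis
    using assms unfolding residue_rel_def maximal_ideal_def valuation_ring_def eq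
    by (simp only: mem_Collect_eq val_uminus)
qed

lemma residue_rel_diff:
  "residue_rel x x' \<Longrightarrow> residue_rel y y' \<Longrightarrow> residue_rel (x - y) (x' - y')"
  using residue_rel_add[of x x' "- y" "- y'"] residue_rel_uminus[of y y'] by simp

lemma residue_rel_val_pos:
  assumes "residue_rel x y" "0 < val x"
  shows "0 < val y"
proof -
  have "0 < val (x + - (x - y))"
    using assms by (intro val_add_gt) (auto simp: residue_rel_def maximal_ideal_def simp del: minus_diff_eq)
  then show ?thesis by simp
qed

lemma residue_rel_inverse:
  assumes "residue_rel x y"
  shows "residue_rel (if val x = 0 then inverse x else 0) (if val y = 0 then inverse y else 0)"
proof -
  have ge: "0 \<le> val x" "0 \<le> val y"
    using assms by (auto simp: residue_rel_def valuation_ring_def)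
  have iff: "val x = 0 \<longleftrightarrow> val y = 0"
    using residue_rel_val_pos[OF assms] residue_rel_val_pos[OF residue_rel_sym[OF assms]] ge
    by (metis less_irrefl order_le_imp_less_or_eq)
  show ?thesis
  proof (cases "val x = 0")
    case True
    then have y0: "val y = 0" using iff by simp
    have nz: "x \<noteq> 0" "y \<noteq> 0" using True y0 by auto
    have ix: "val (inverse x) = 0" "val (inverse y) = 0"
      using nz True y0 by (auto simp: val_inverse rval_def)
    have eq: "inverse x - inverse y = (y - x) * (inverse x * inverse y)"
      using nz by (simp add: field_simps)
    have "0 < val (y - x)"
      using residue_rel_sym[OF assms] by (simp add: residue_rel_def maximal_ideal_def)
    then have "0 < val (inverse x - inverse y)"
      unfolding eq by (intro val_mult_gt0) (auto simp: val_mult ix)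
    then show ?thesis
      using True y0 ix by (simp add: residue_rel_def valuation_ring_def maximal_ideal_def)
  next
    case False
    then show ?thesis using iff by (simp add: residue_rel_refl)
  qed
qed

instantiation residue :: (valued_field) field
begin

lift_definition zero_residue :: "'a residue" is 0
  by (simp add: residue_rel_refl)

lift_definition one_residue :: "'a residue" is 1
  by (simp add: residue_rel_refl)

lift_definition plus_residue :: "'a residue \<Rightarrow> 'a residue \<Rightarrow> 'a residue" is "(+)"
  by (rule residue_rel_add)

lift_definition uminus_residue :: "'a residue \<Rightarrow> 'a residue" is uminus
  by (rule residue_rel_uminus)

lift_definition minus_residue :: "'a residue \<Rightarrow> 'a residue \<Rightarrow> 'a residue" is "(-)"
  by (rule residue_rel_diff)

lift_definition times_residue :: "'a residue \<Rightarrow> 'a residue \<Rightarrow> 'a residue" is "(*)"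
  by (rule residue_rel_mult)

lift_definition inverse_residue :: "'a residue \<Rightarrow> 'a residue"
  is "\<lambda>x. if val x = 0 then inverse x else 0"
  by (rule residue_rel_inverse)

definition divide_residue :: "'a residue \<Rightarrow> 'a residue \<Rightarrow> 'a residue"
  where "divide_residue x y = x * inverse y"

instance
proof
  fix a b c :: "'a residue"
  show "a * b * c = a * (b * c)"
    by transfer (simp add: mult.assoc residue_rel_refl val_mult_ge0)
  show "a * b = b * a"
    by transfer (simp add: mult.commute residue_rel_refl val_mult_ge0)
  show "1 * a = a"
    by transfer simp
  show "a + b + c = a + (b + c)"
    by transfer (simp add: add.assoc residue_rel_refl val_add_ge)
  show "a + b = b + a"
    by transfer (simp add: add.commute residue_rel_refl val_add_ge)
  show "0 + a = a"
    by transfer simp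
  show "- a + a = 0"
    by transfer (simp add: residue_rel_refl)
  show "a - b = a + - b"
    by transfer (simp add: residue_rel_refl val_diff_ge)
  show "(a + b) * c = a * c + b * c"
    by transfer (simp add: distrib_right residue_rel_refl val_add_ge val_mult_ge0)
  show "(0::'a residue) \<noteq> 1"
    by transfer (simp add: residue_rel_def maximal_ideal_def)
  show "a \<noteq> 0 \<Longrightarrow> inverse a * a = 1"
  proof transfer
    fix a :: 'a
    assume a: "residue_rel a a" and "\<not> residue_rel a 0"
    then have "val a = 0"
      by (auto simp: residue_rel_def valuation_ring_def maximal_ideal_def)
    moreover then have "a \<noteq> 0" by auto
    ultimately show "residue_rel ((if val a = 0 then inverse a else 0) * a) 1"
      by (simp add: residue_rel_refl)
  qed
  show "a div b = a * inverse b"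
    by (rule divide_residue_def)
  show "inverse (0::'a residue) = 0"
    by transfer (simp add: residue_rel_refl)
qed

end

text \<open>
  For \<open>x \<noteq> 0\<close> and a uniformizer \<open>\<pi>\<close>, the quotient \<open>val x / val \<pi>\<close> is an integer, so the floor
  merely changes its type, and \<open>abs_residue\<close> is applied to an element of valuation \<open>0\<close>.
  The values for \<open>x = 0\<close> are irrelevant.
\<close>

definition first_digit :: "'a::valued_field \<Rightarrow> 'a \<Rightarrow> 'a residue"
  where "first_digit \<pi> x = abs_residue (\<pi> powi (- \<lfloor>rval x / rval \<pi>\<rfloor>) * x)"


section \<open>Laurent polynomials\<close>

text \<open>
  The Laurent polynomial ring is the group ring of \<open>\<int>\<^sup>n\<close>: finitely supported functions from exponent
  vectors to coefficients. The terms of a polynomial are indexed by its support \<open>keys f\<close>.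
\<close>

type_synonym ('a, 'n) laurent = "(int ^ 'n) \<Rightarrow>\<^sub>0 'a"

definition laurent_eval :: "('a::field, 'n::finite) laurent \<Rightarrow> 'a ^ 'n \<Rightarrow> 'a"
  where "laurent_eval f x =
    (\<Sum>\<alpha>\<in>Poly_Mapping.keys f. Poly_Mapping.lookup f \<alpha> * (\<Prod>j\<in>UNIV. (x $ j) powi (\<alpha> $ j)))"

definition laurent_pderiv :: "'n \<Rightarrow> ('a::field, 'n::finite) laurent \<Rightarrow> ('a, 'n) laurent"
  where "laurent_pderiv j f =
    (\<Sum>\<alpha>\<in>Poly_Mapping.keys f.
       Poly_Mapping.single (\<alpha> - axis j 1) (of_int (\<alpha> $ j) * Poly_Mapping.lookup f \<alpha>))"

definition torus_zeros :: "('a::field, 'n::finite) laurent ^ 'n \<Rightarrow> ('a ^ 'n) set"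
  where "torus_zeros F = {x. (\<forall>j. x $ j \<noteq> 0) \<and> (\<forall>i. laurent_eval (F $ i) x = 0)}"

definition jacobian_matrix :: "('a::field, 'n::finite) laurent ^ 'n \<Rightarrow> 'a ^ 'n \<Rightarrow> 'a ^ 'n ^ 'n"
  where "jacobian_matrix F x = (\<chi> i j. laurent_eval (laurent_pderiv j (F $ i)) x)"

definition degenerate_zero :: "('a::field, 'n::finite) laurent ^ 'n \<Rightarrow> 'a ^ 'n \<Rightarrow> bool"
  where "degenerate_zero F x \<longleftrightarrow> x \<in> torus_zeros F \<and> det (jacobian_matrix F x) = 0"


section \<open>Tropical hypersurfaces and initial forms\<close>

definition trop_term ::
    "('a::valued_field, 'n::finite) laurent \<Rightarrow> int ^ 'n \<Rightarrow> real ^ 'n \<Rightarrow> real"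
  where "trop_term f \<alpha> w = rval (Poly_Mapping.lookup f \<alpha>) + (\<chi> j. of_int (\<alpha> $ j)) \<bullet> w"

text \<open>Only meaningful for \<open>f \<noteq> 0\<close>, so that the minimum is over a nonempty set.\<close>

definition tr :: "('a::valued_field, 'n::finite) laurent \<Rightarrow> real ^ 'n \<Rightarrow> real"
  where "tr f w = Min ((\<lambda>\<alpha>. trop_term f \<alpha> w) ` Poly_Mapping.keys f)"

definition Trop :: "('a::valued_field, 'n::finite) laurent \<Rightarrow> (real ^ 'n) set"
  where "Trop f = {w. \<not> tr f differentiable (at w)}"

definition Trop_system :: "('a::valued_field, 'n::finite) laurent ^ 'n \<Rightarrow> (real ^ 'n) set"
  where "Trop_system F = (\<Inter>i. Trop (F $ i))"

definition initial_form ::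
    "'a::valued_field \<Rightarrow> real ^ 'n \<Rightarrow> ('a, 'n::finite) laurent \<Rightarrow> ('a residue, 'n) laurent"
  where "initial_form \<pi> w f =
    (\<Sum>\<alpha> | \<alpha> \<in> Poly_Mapping.keys f \<and> trop_term f \<alpha> w = tr f w.
       Poly_Mapping.single \<alpha> (first_digit \<pi> (Poly_Mapping.lookup f \<alpha>)))"

definition initial_system ::
    "'a::valued_field \<Rightarrow> real ^ 'n \<Rightarrow> ('a, 'n::finite) laurent ^ 'n \<Rightarrow>
      ('a residue, 'n) laurent ^ 'n"
  where "initial_system \<pi> w F = (\<chi> i. initial_form \<pi> w (F $ i))"

end

theory Submission
  imports Defs
begin

text \<open>
  Write \<open>w = rval \<pi> \<cdot> m\<close> with an integer vector \<open>m\<close>. The points of valuation vector \<open>w\<close> are the points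
  \<open>x = \<pi>\<^sup>m u\<close> whose coordinates \<open>u\<^sub>j\<close> have valuation \<open>0\<close>, and the first digit of \<open>x\<close> is the residue of \<open>u\<close>.
  After the substitution and division by a suitable power of \<open>\<pi>\<close>, each \<open>f\<^sub>i\<close> becomes a Laurent polynomial
  \<open>g\<^sub>i\<close> with integral coefficients whose reduction is the initial form of \<open>f\<^sub>i\<close>
  (\<open>initial_form_eq_reduction\<close>). The claim becomes that reduction is a bijection from the zeros of the
  \<open>g\<^sub>i\<close> with unit coordinates to the zeros of the reduced system in the torus.

  A zero of the \<open>g\<^sub>i\<close> reduces to a zero because reduction is a ring homomorphism. Conversely, every zero
  of the reduced system has an invertible Jacobian matrix, and the multivariate Hensel lemma
  (\<open>multivariate_hensel\<close>) says that exactly one zero of the \<open>g\<^sub>i\<close> lies above it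
  (\<open>nondegenerate_zero_lifts_uniquely\<close>).

  The analytic input to Hensel's lemma is that on a residue class of unit vectors a Laurent monomial
  agrees with its linearization up to terms of higher order (\<open>laurent_monom_expansion\<close>). A monomial is
  multiplicative, and modulo higher-order terms the group of units \<open>1 + s\<close> with small \<open>s\<close> is additive
  in \<open>s\<close>, so an exponent, positive or negative, acts on \<open>s\<close> as an integer factor.
\<close>


section \<open>Arithmetic of valuations\<close>

lemma val_mult_ge:
  fixes a b :: "'a::valued_field"
  assumes "0 \<le> val a" "ereal D \<le> val b"
  shows "ereal D \<le> val (a * b)"
  using add_mono[OF assms] by (simp add: val_mult)

lemma val_mult_gt:
  fixes a b :: "'a::valued_field"
  assumes "0 \<le> val a" "ereal D < val b"
  shows "ereal D < val (a * b)"
proof -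
  have "val b \<le> val (a * b)"
    using add_mono[OF assms(1) order_refl[of "val b"]] by (simp add: val_mult)
  then show ?thesis
    using assms(2) by (rule order_less_le_trans[rotated])
qed

lemma val_mult_gt':
  fixes a b :: "'a::valued_field"
  assumes "0 < val a" "ereal D \<le> val b"
  shows "ereal D < val (a * b)"
  using assms by (cases "val a"; cases "val b") (auto simp: val_mult)

lemma val_sum_ge:
  fixes f :: "'i \<Rightarrow> 'a::valued_field"
  assumes "\<And>i. i \<in> A \<Longrightarrow> ereal D \<le> val (f i)"
  shows "ereal D \<le> val (sum f A)"
  using assms by (induction A rule: infinite_finite_induct) (auto intro: val_add_ge)

lemma val_sum_ge_0:
  fixes f :: "'i \<Rightarrow> 'a::valued_field"
  shows "(\<And>i. i \<in> A \<Longrightarrow> 0 \<le> val (f i)) \<Longrightarrow> 0 \<le> val (sum f A)"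
  using val_sum_ge[of A 0 f] by (simp add: zero_ereal_def)

lemma val_sum_gt:
  fixes f :: "'i \<Rightarrow> 'a::valued_field"
  assumes "\<And>i. i \<in> A \<Longrightarrow> ereal D < val (f i)"
  shows "ereal D < val (sum f A)"
  using assms by (induction A rule: infinite_finite_induct) (auto intro: val_add_gt)

lemma val_diff_gt: "c < val x \<Longrightarrow> c < val y \<Longrightarrow> c < val (x - y)" for x y :: "'a::valued_field"
  using val_add_gt[of c x "- y"] by simp

lemma val_powi:
  fixes x :: "'a::valued_field"
  assumes "val x = ereal r"
  shows "val (x powi n) = ereal (of_int n * r)"
proof -
  have nz: "x \<noteq> 0"
    using assms by auto
  have up: "val (x powi (i + 1)) = ereal (of_int i * r) + ereal r"
    if "val (x powi i) = ereal (of_int i * r)" for i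
    using that nz assms by (simp add: power_int_add_1 val_mult)
  have down: "val (x powi (i - 1)) = ereal (of_int i * r) - ereal r"
    if "val (x powi i) = ereal (of_int i * r)" for i
  proof -
    have "val (x powi i) = val (x powi (i - 1)) + ereal r"
      using nz assms power_int_add_1[of x "i - 1"] by (simp add: val_mult)
    then show ?thesis
      using that by (cases "val (x powi (i - 1))") auto
  qed
  show ?thesis
    by (induction n rule: int_induct[where k = 0])
      (auto simp: up down algebra_simps zero_ereal_def)
qed

lemma val_prod_eq_0:
  fixes f :: "'i \<Rightarrow> 'a::valued_field"
  assumes "\<And>i. i \<in> A \<Longrightarrow> val (f i) = 0"
  shows "val (prod f A) = 0"
  using assms by (induction A rule: infinite_finite_induct) (auto simp: val_mult)

lemma val_of_int: "0 \<le> val (of_int n :: 'a::valued_field)"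
proof (induction n rule: int_induct[where k = 0])
  case (step1 i)
  then show ?case using val_add_ge[of 0 "of_int i :: 'a" 1] by simp
next
  case (step2 i)
  then show ?case using val_diff_ge[of 0 "of_int i :: 'a" 1] by simp
qed simp

lemma val_eq_0_if_close:
  fixes x y :: "'a::valued_field"
  assumes "0 < val (x - y)" "val y = 0"
  shows "val x = 0"
proof (rule antisym)
  show "0 \<le> val x"
    using val_add_ge[of 0 "x - y" y] assms by simp
  show "val x \<le> 0"
  proof (rule ccontr)
    assume "\<not> val x \<le> 0"
    then show False
      using assms val_diff_gt[of 0 x "x - y"] by (simp add: not_le)
  qed
qed

text \<open>
  The next three facts have one source. Some \<open>x\<close> has valuation \<open>c\<close>, the positive generator of the value
  group. As \<open>x\<close> lies in the maximal ideal, it is an integral multiple of \<open>\<pi>\<close>, so the valuation of \<open>\<pi>\<close>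
  is at most \<open>c\<close>, and being a positive multiple of \<open>c\<close> it equals \<open>c\<close>.
\<close>

lemma
  fixes \<pi> :: "'a::complete_discrete_valued_field"
  assumes "uniformizer \<pi>"
  shows uniformizer_neq_0: "\<pi> \<noteq> 0"
    and uniformizer_rval_pos: "0 < rval \<pi>"
    and rval_multiple_of_uniformizer:
      "\<And>x::'a. x \<noteq> 0 \<Longrightarrow> \<exists>m::int. rval x = rval \<pi> * of_int m"
proof -
  obtain c :: real where c: "c > 0"
    "val ` (UNIV - {0::'a}) = range (\<lambda>m::int. ereal (c * of_int m))"
    using val_discrete by blast
  have "ereal (c * of_int 1) \<in> val ` (UNIV - {0::'a})"
    unfolding c(2) by blast
  then obtain x :: 'a where x: "x \<noteq> 0" "val x = ereal c"
    by (metis DiffD2 imageE mult_1_right of_int_1 singletonI)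
  have "x \<in> maximal_ideal"
    using x c(1) by (simp add: maximal_ideal_def)
  then obtain a where a: "x = \<pi> * a" "0 \<le> val a"
    using assms unfolding uniformizer_def valuation_ring_def by blast
  have nz: "\<pi> \<noteq> 0" "a \<noteq> 0"
    using a x by auto
  have "\<pi> * 1 \<in> (\<lambda>a. \<pi> * a) ` valuation_ring"
    by (rule imageI) (simp add: valuation_ring_def)
  then have "\<pi> * 1 \<in> maximal_ideal"
    using assms by (simp only: uniformizer_def)
  then have pos: "0 < rval \<pi>"
    using nz by (simp add: maximal_ideal_def val_rval)
  have le: "rval \<pi> \<le> c"
    using a x nz val_mult[of \<pi> a] by (simp add: val_rval)
  have ex: "\<exists>m::int. rval y = c * of_int m" if "y \<noteq> 0" for y :: 'a
  proof -
    have "val y \<in> val ` (UNIV - {0::'a})"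
      using that by blast
    then show ?thesis
      unfolding c(2) using that by (auto simp: val_rval)
  qed
  obtain m :: int where m: "rval \<pi> = c * of_int m"
    using ex nz by blast
  have "0 < m" "m \<le> 1"
    using m pos le c(1) by (auto simp: zero_less_mult_iff mult_le_cancel_left1 mult_le_cancel_left2)
  then have "rval \<pi> = c"
    using m by simp
  then show "\<pi> \<noteq> 0" "0 < rval \<pi>"
    "\<And>x::'a. x \<noteq> 0 \<Longrightarrow> \<exists>m::int. rval x = rval \<pi> * of_int m"
    using nz pos ex by simp_all
qed

text \<open>
  Discreteness turns a strict bound into the next larger bound. This is what makes every error term
  that is merely of higher order count as a definite gain in an iteration.
\<close>

lemma val_gt_multiple_imp_ge:
  fixes \<pi> x :: "'a::complete_discrete_valued_field"
  assumes "uniformizer \<pi>" "ereal (rval \<pi> * of_nat k) < val x"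
  shows "ereal (rval \<pi> * of_nat (Suc k)) \<le> val x"
proof (cases "x = 0")
  case False
  have pos: "0 < rval \<pi>"
    using assms(1) by (rule uniformizer_rval_pos)
  obtain m :: int where m: "rval x = rval \<pi> * of_int m"
    using rval_multiple_of_uniformizer[OF assms(1)] False by metis
  have "rval \<pi> * of_nat k < rval \<pi> * of_int m"
    using assms(2) False m by (simp add: val_rval)
  then have "int k < m"
    using pos by simp
  then have "rval \<pi> * of_nat (Suc k) \<le> rval \<pi> * of_int m"
    using pos by (intro mult_left_mono) linarith+
  then show ?thesis
    using False m by (simp add: val_rval)
qed simp


section \<open>The residue map\<close>

lemma abs_residue_eq_iff:
  fixes x y :: "'a::valued_field"
  assumes "0 \<le> val x" "0 \<le> val y"
  shows "abs_residue x = abs_residue y \<longleftrightarrow> 0 < val (x - y)"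
  using Quotient_rel_abs2[OF Quotient_residue] Quotient_rel[OF Quotient_residue, of x y] assms
  by (auto simp: residue_rel_def valuation_ring_def maximal_ideal_def)

lemma abs_residue_eq_0_iff:
  fixes x :: "'a::valued_field"
  assumes "0 \<le> val x"
  shows "abs_residue x = 0 \<longleftrightarrow> 0 < val x"
  using abs_residue_eq_iff[OF assms, of 0] by (simp add: zero_residue.abs_eq)

lemma abs_residue_cases:
  obtains x :: "'a::valued_field" where "0 \<le> val x" "z = abs_residue x"
  by (induction z rule: residue.abs_induct) (auto simp: residue_rel_refl)

lemma abs_residue_mult:
  fixes x y :: "'a::valued_field"
  assumes "0 \<le> val x" "0 \<le> val y"
  shows "abs_residue (x * y) = abs_residue x * abs_residue y"
  using assms by (simp add: times_residue.abs_eq residue_rel_refl)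

lemma abs_residue_add:
  fixes x y :: "'a::valued_field"
  assumes "0 \<le> val x" "0 \<le> val y"
  shows "abs_residue (x + y) = abs_residue x + abs_residue y"
  using assms by (simp add: plus_residue.abs_eq residue_rel_refl)

lemma abs_residue_diff:
  fixes x y :: "'a::valued_field"
  assumes "0 \<le> val x" "0 \<le> val y"
  shows "abs_residue (x - y) = abs_residue x - abs_residue y"
  using assms by (simp add: minus_residue.abs_eq residue_rel_refl)

lemma abs_residue_sum:
  fixes f :: "'i \<Rightarrow> 'a::valued_field"
  assumes "\<And>i. i \<in> A \<Longrightarrow> 0 \<le> val (f i)"
  shows "abs_residue (sum f A) = (\<Sum>i\<in>A. abs_residue (f i))"
  using assms
proof (induction A rule: infinite_finite_induct)
  case (insert i A)
  then have "0 \<le> val (sum f A)"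
    by (intro val_sum_ge_0) auto
  then show ?case
    using insert by (simp add: abs_residue_add)
qed (simp_all add: zero_residue.abs_eq)

lemma abs_residue_prod:
  fixes f :: "'i \<Rightarrow> 'a::valued_field"
  assumes "\<And>i. i \<in> A \<Longrightarrow> val (f i) = 0"
  shows "abs_residue (prod f A) = (\<Prod>i\<in>A. abs_residue (f i))"
  using assms
  by (induction A rule: infinite_finite_induct)
    (simp_all add: one_residue.abs_eq abs_residue_mult val_prod_eq_0)

lemma abs_residue_of_int: "abs_residue (of_int n :: 'a::valued_field) = of_int n"
proof (induction n rule: int_induct[where k = 0])
  case (step1 i)
  then show ?case
    using abs_residue_add[of "of_int i :: 'a" 1] by (simp add: val_of_int one_residue.abs_eq)
next
  case (step2 i)
  then show ?case
    using abs_residue_diff[of "of_int i :: 'a" 1] by (simp add: val_of_int one_residue.abs_eq)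
qed (simp add: zero_residue.abs_eq)

lemma abs_residue_powi:
  fixes x :: "'a::valued_field"
  assumes "val x = 0"
  shows "abs_residue (x powi n) = abs_residue x powi n"
proof -
  have nz: "x \<noteq> 0" "abs_residue x \<noteq> 0"
    using assms by (auto simp: abs_residue_eq_0_iff)
  have unit: "val (x powi i) = 0" for i
    using assms val_powi[of x 0] by (simp add: zero_ereal_def)
  show ?thesis
  proof (induction n rule: int_induct[where k = 0])
    case (step1 i)
    then show ?case
      using nz unit assms by (simp add: power_int_add_1 abs_residue_mult)
  next
    case (step2 i)
    have "abs_residue x powi (i - 1) * abs_residue x = abs_residue (x powi (i - 1) * x)"
      using step2 nz power_int_add_1[of x "i - 1"] power_int_add_1[of "abs_residue x" "i - 1"]
      by simp
    also have "\<dots> = abs_residue (x powi (i - 1)) * abs_residue x"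
      using unit assms by (simp add: abs_residue_mult)
    finally show ?case
      using nz by simp
  qed (simp add: one_residue.abs_eq)
qed


section \<open>Evaluating Laurent polynomials\<close>

definition laurent_monom :: "int ^ 'n::finite \<Rightarrow> 'a::field ^ 'n \<Rightarrow> 'a"
  where "laurent_monom \<alpha> x = (\<Prod>j\<in>UNIV. (x $ j) powi (\<alpha> $ j))"

lemma laurent_eval_monom:
  "laurent_eval f x = (\<Sum>\<alpha>\<in>Poly_Mapping.keys f. Poly_Mapping.lookup f \<alpha> * laurent_monom \<alpha> x)"
  by (simp add: laurent_eval_def laurent_monom_def)

lemma laurent_eval_0 [simp]: "laurent_eval 0 x = 0"
  by (simp add: laurent_eval_monom)

lemma laurent_eval_single [simp]:
  "laurent_eval (Poly_Mapping.single \<alpha> a) x = a * laurent_monom \<alpha> x"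
  by (simp add: laurent_eval_monom)

lemma laurent_eval_add: "laurent_eval (f + g) x = laurent_eval f x + laurent_eval g x"
  unfolding laurent_eval_monom
  by (rule setsum_keys_plus_distrib[where f = "\<lambda>\<alpha> a. a * laurent_monom \<alpha> x"])
    (simp_all add: distrib_right)

text \<open>
  Sums over a larger index set allow a polynomial to be evaluated over the support of another one,
  such as the polynomial of which it is the reduction.
\<close>

lemma laurent_eval_superset:
  assumes "finite A" "Poly_Mapping.keys f \<subseteq> A"
  shows "laurent_eval f x = (\<Sum>\<alpha>\<in>A. Poly_Mapping.lookup f \<alpha> * laurent_monom \<alpha> x)"
  unfolding laurent_eval_monom using assms
  by (intro sum.mono_neutral_left) (auto simp: in_keys_iff)

lemma laurent_eval_sum: "laurent_eval (sum f A) x = (\<Sum>i\<in>A. laurent_eval (f i) x)"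
  by (induction A rule: infinite_finite_induct) (simp_all add: laurent_eval_add)

lemma laurent_eval_pderiv:
  "laurent_eval (laurent_pderiv j f) x =
    (\<Sum>\<alpha>\<in>Poly_Mapping.keys f.
      of_int (\<alpha> $ j) * Poly_Mapping.lookup f \<alpha> * laurent_monom (\<alpha> - axis j 1) x)"
  by (simp add: laurent_pderiv_def laurent_eval_sum)

lemma laurent_eval_pderiv_superset:
  assumes "finite A" "Poly_Mapping.keys f \<subseteq> A"
  shows "laurent_eval (laurent_pderiv j f) x =
    (\<Sum>\<alpha>\<in>A. of_int (\<alpha> $ j) * Poly_Mapping.lookup f \<alpha> * laurent_monom (\<alpha> - axis j 1) x)"
  unfolding laurent_eval_pderiv using assms
  by (intro sum.mono_neutral_left) (auto simp: in_keys_iff)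

lemma laurent_monom_mult:
  "laurent_monom \<alpha> (\<chi> j. x $ j * y $ j) = laurent_monom \<alpha> x * laurent_monom \<alpha> y"
  by (simp add: laurent_monom_def power_int_mult_distrib prod.distrib)

lemma laurent_monom_powi:
  assumes "a \<noteq> 0"
  shows "laurent_monom \<alpha> (\<chi> j. a powi (m j)) = a powi (\<Sum>j\<in>UNIV. \<alpha> $ j * m j)"
proof -
  have "(\<Prod>j\<in>A. (a powi (m j)) powi (\<alpha> $ j)) = a powi (\<Sum>j\<in>A. \<alpha> $ j * m j)" for A
    by (induction A rule: infinite_finite_induct)
      (simp_all add: assms power_int_add mult.commute flip: power_int_mult)
  then show ?thesis
    by (simp add: laurent_monom_def)
qed

lemma laurent_monom_shift:
  assumes "x $ j \<noteq> 0"
  shows "laurent_monom (\<alpha> - axis j 1) x = laurent_monom \<alpha> x / x $ j"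
proof -
  have "laurent_monom (\<alpha> - axis j 1) x = 
      (x $ j) powi (\<alpha> $ j - 1) * (\<Prod>i\<in>UNIV - {j}. (x $ i) powi (\<alpha> $ i))"
    unfolding laurent_monom_def by (subst prod.remove[of _ j]) (auto simp: axis_def)
  moreover have "laurent_monom \<alpha> x = 
      (x $ j) powi (\<alpha> $ j) * (\<Prod>i\<in>UNIV - {j}. (x $ i) powi (\<alpha> $ i))"
    unfolding laurent_monom_def by (subst prod.remove[of _ j]) auto
  ultimately show ?thesis
    using assms by (simp add: power_int_diff)
qed

lemma val_laurent_monom_unit:
  fixes x :: "'a::valued_field ^ 'n"
  assumes "\<And>j. val (x $ j) = 0"
  shows "val (laurent_monom \<alpha> x) = 0"
proof -
  have "val ((x $ j) powi i) = 0" for i j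
    using assms val_powi[of "x $ j" 0] by (simp add: zero_ereal_def)
  then show ?thesis
    unfolding laurent_monom_def by (intro val_prod_eq_0) auto
qed

lemma abs_residue_laurent_monom:
  fixes x :: "'a::valued_field ^ 'n"
  assumes "\<And>j. val (x $ j) = 0"
  shows "abs_residue (laurent_monom \<alpha> x) = laurent_monom \<alpha> (\<chi> j. abs_residue (x $ j))"
proof -
  have "val ((x $ j) powi i) = 0" for i j
    using assms val_powi[of "x $ j" 0] by (simp add: zero_ereal_def)
  then show ?thesis
    unfolding laurent_monom_def using assms by (simp add: abs_residue_prod abs_residue_powi)
qed


section \<open>First-order expansion of monomials\<close>

text \<open>
  For \<open>D > 0\<close> this says \<open>r = 1 + s + \<dots>\<close> with \<open>s\<close> of valuation at least \<open>D\<close> and an error of valuation above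
  \<open>D\<close>. Products of such small terms have valuation at least \<open>2 D\<close> and are absorbed in the error.
  Hence \<open>r \<mapsto> s\<close> turns multiplication into addition, like a truncated logarithm. Laurent monomials
  are products of powers, possibly negative, so their expansion reduces to sums and integer
  multiples, in any characteristic of the residue field.
\<close>

definition first_order :: "real \<Rightarrow> 'a::valued_field \<Rightarrow> 'a \<Rightarrow> bool"
  where "first_order D r s \<longleftrightarrow> ereal D \<le> val s \<and> ereal D < val (r - 1 - s)"

lemma first_order_val:
  assumes "first_order D r s"
  shows "ereal D \<le> val (r - 1)"
  using assms val_add_ge[of "ereal D" "r - 1 - s" s] less_imp_le[of "ereal D"]
  by (auto simp: first_order_def)

lemma first_order_mult:
  assumes "0 < D" "first_order D r s" "first_order D r' s'"
  shows "first_order D (r * r') (s + s')"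
proof -
  have "0 < val (r - 1)"
    using first_order_val[OF assms(2)] assms(1) by (cases "val (r - 1)") auto
  then have "ereal D < val ((r - 1) * (r' - 1))"
    using first_order_val[OF assms(3)] by (rule val_mult_gt')
  moreover have "ereal D < val ((r - 1 - s) + (r' - 1 - s'))"
    using assms by (intro val_add_gt) (simp_all add: first_order_def)
  ultimately have "ereal D < val ((r - 1) * (r' - 1) + ((r - 1 - s) + (r' - 1 - s')))"
    by (rule val_add_gt)
  also have "(r - 1) * (r' - 1) + ((r - 1 - s) + (r' - 1 - s')) = r * r' - 1 - (s + s')"
    by (simp add: algebra_simps)
  finally show ?thesis
    using assms by (auto simp: first_order_def val_add_ge)
qed

lemma first_order_inverse:
  assumes "0 < D" "first_order D r s"
  shows "first_order D (inverse r) (- s)"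
proof -
  have gt: "0 < val (r - 1)"
    using first_order_val[OF assms(2)] assms(1) by (cases "val (r - 1)") auto
  then have r: "val r = 0"
    using val_eq_0_if_close[of r 1] by simp
  then have nz: "r \<noteq> 0"
    by auto
  have ri: "0 \<le> val (inverse r)"
    using r nz by (simp add: val_inverse rval_def)
  have "ereal D < val ((r - 1) * s - (r - 1 - s))"
    using assms val_diff_gt[OF val_mult_gt'[OF gt]] by (simp add: first_order_def)
  then have "ereal D < val (inverse r * ((r - 1) * s - (r - 1 - s)))"
    using ri by (intro val_mult_gt)
  moreover have "inverse r * ((r - 1) * s - (r - 1 - s)) = inverse r - 1 - (- s)"
    using nz by (simp add: field_simps)
  ultimately show ?thesis
    using assms by (simp add: first_order_def)
qed

lemma first_order_powi:
  assumes "0 < D" "first_order D r s"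
  shows "first_order D (r powi n) (of_int n * s)"
proof -
  have pow: "first_order D (x ^ k) (of_nat k * t)" if "first_order D x t" for x t :: 'a and k
  proof (induction k)
    case (Suc k)
    then show ?case
      using first_order_mult[OF assms(1) that Suc] by (simp add: algebra_simps)
  qed (simp add: first_order_def)
  show ?thesis
  proof (cases "0 \<le> n")
    case True
    then show ?thesis
      using pow[OF assms(2), of "nat n"] by (simp add: power_int_def)
  next
    case False
    then show ?thesis
      using pow[OF first_order_inverse[OF assms], of "nat (- n)"] by (simp add: power_int_def)
  qed
qed

lemma first_order_prod:
  assumes "0 < D" "\<And>i. i \<in> A \<Longrightarrow> first_order D (r i) (s i)"
  shows "first_order D (prod r A) (sum s A)"
  using assms(2)
  by (induction A rule: infinite_finite_induct)
    (simp_all add: first_order_mult[OF assms(1)] first_order_def[of D 1 0])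

text \<open>
  First-order Taylor expansion, obtained by applying the truncated logarithm to the quotients
  \<open>x\<^sub>j / y\<^sub>j\<close>. The gradient is taken at the centre \<open>u\<close> of the residue class rather than at \<open>y\<close>, so that
  one linear map serves all pairs of points of the class.
\<close>

lemma laurent_monom_expansion:
  fixes x y u :: "'a::valued_field ^ 'n"
  assumes D: "0 < D"
    and u: "\<And>j. val (u $ j) = 0"
    and y: "\<And>j. 0 < val (y $ j - u $ j)"
    and close: "\<And>j. ereal D \<le> val (x $ j - y $ j)"
  shows "ereal D < val (laurent_monom \<alpha> x - laurent_monom \<alpha> y
           - (\<Sum>j\<in>UNIV. of_int (\<alpha> $ j) * laurent_monom (\<alpha> - axis j 1) u * (x $ j - y $ j)))"
proof -
  have unit_y: "val (y $ j) = 0" for j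
    using val_eq_0_if_close y u by blast
  have nz: "y $ j \<noteq> 0" "u $ j \<noteq> 0" for j
    using unit_y[of j] u[of j] by auto
  define s where "s = (\<lambda>j. (x $ j - y $ j) / y $ j)"
  have s: "ereal D \<le> val (s j)" for j
  proof -
    have "0 \<le> val (inverse (y $ j))"
      using unit_y[of j] nz by (simp add: val_inverse rval_def)
    then show ?thesis
      using val_mult_ge[OF _ close] by (simp add: s_def divide_inverse mult.commute)
  qed
  have r: "first_order D (x $ j / y $ j) (s j)" for j
    using s nz by (simp add: first_order_def s_def diff_divide_distrib)
  have "first_order D (\<Prod>j\<in>UNIV. (x $ j / y $ j) powi (\<alpha> $ j)) (\<Sum>j\<in>UNIV. of_int (\<alpha> $ j) * s j)"
    by (intro first_order_prod first_order_powi D r)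
  moreover have "(\<Prod>j\<in>UNIV. (x $ j / y $ j) powi (\<alpha> $ j)) = laurent_monom \<alpha> x / laurent_monom \<alpha> y"
    by (simp add: laurent_monom_def power_int_divide_distrib prod_dividef)
  ultimately have "ereal D < val (laurent_monom \<alpha> x / laurent_monom \<alpha> y - 1
      - (\<Sum>j\<in>UNIV. of_int (\<alpha> $ j) * s j))"
    by (simp add: first_order_def)
  then have "ereal D < val (laurent_monom \<alpha> y * (laurent_monom \<alpha> x / laurent_monom \<alpha> y - 1
      - (\<Sum>j\<in>UNIV. of_int (\<alpha> $ j) * s j)))"
    using val_laurent_monom_unit[of y \<alpha>, OF unit_y] by (intro val_mult_gt) auto
  moreover have "laurent_monom \<alpha> y * (laurent_monom \<alpha> x / laurent_monom \<alpha> y - 1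
      - (\<Sum>j\<in>UNIV. of_int (\<alpha> $ j) * s j)) = laurent_monom \<alpha> x - laurent_monom \<alpha> y
      - (\<Sum>j\<in>UNIV. of_int (\<alpha> $ j) * laurent_monom (\<alpha> - axis j 1) y * (x $ j - y $ j))"
  proof -
    have "laurent_monom \<alpha> y \<noteq> 0"
      using val_laurent_monom_unit[of y \<alpha>, OF unit_y] by auto
    moreover have summand: "laurent_monom \<alpha> y * (of_int (\<alpha> $ j) * s j) =
        of_int (\<alpha> $ j) * laurent_monom (\<alpha> - axis j 1) y * (x $ j - y $ j)" for j
      by (simp add: s_def laurent_monom_shift[OF nz(1)])
    moreover have "laurent_monom \<alpha> y * (\<Sum>j\<in>UNIV. of_int (\<alpha> $ j) * s j) =
        (\<Sum>j\<in>UNIV. of_int (\<alpha> $ j) * laurent_monom (\<alpha> - axis j 1) y * (x $ j - y $ j))"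
      unfolding sum_distrib_left by (rule sum.cong[OF refl summand])
    ultimately show ?thesis
      by (simp only: right_diff_distrib[of "laurent_monom \<alpha> y"]) simp
  qed
  ultimately have at_y: "ereal D < val (laurent_monom \<alpha> x - laurent_monom \<alpha> y
      - (\<Sum>j\<in>UNIV. of_int (\<alpha> $ j) * laurent_monom (\<alpha> - axis j 1) y * (x $ j - y $ j)))"
    by simp
  \<comment> \<open>Replacing the gradient at \<open>y\<close> by the one at \<open>u\<close> changes it by elements of the maximal ideal.\<close>
  have res: "abs_residue (y $ j) = abs_residue (u $ j)" for j
    using y[of j] unit_y[of j] u[of j] by (simp add: abs_residue_eq_iff)
  have grad: "0 < val (laurent_monom \<beta> y - laurent_monom \<beta> u)" for \<beta>
    using abs_residue_eq_iff[of "laurent_monom \<beta> y" "laurent_monom \<beta> u"]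
    by (simp add: val_laurent_monom_unit unit_y u abs_residue_laurent_monom res)
  have "ereal D < val (of_int (\<alpha> $ j) *
      ((laurent_monom (\<alpha> - axis j 1) y - laurent_monom (\<alpha> - axis j 1) u) * (x $ j - y $ j)))" for j
    using val_of_int val_mult_gt'[OF grad close] by (rule val_mult_gt)
  then have "ereal D < val (\<Sum>j\<in>UNIV. of_int (\<alpha> $ j) *
      ((laurent_monom (\<alpha> - axis j 1) y - laurent_monom (\<alpha> - axis j 1) u) * (x $ j - y $ j)))"
    by (intro val_sum_gt)
  from val_add_gt[OF at_y this] show ?thesis
    by (simp add: algebra_simps sum_subtractf sum.distrib)
qed

lemma laurent_eval_expansion:
  fixes x y u :: "'a::valued_field ^ 'n"
  assumes "0 < D"
    and int: "\<And>\<alpha>. 0 \<le> val (Poly_Mapping.lookup f \<alpha>)"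
    and "\<And>j. val (u $ j) = 0"
    and "\<And>j. 0 < val (y $ j - u $ j)"
    and "\<And>j. ereal D \<le> val (x $ j - y $ j)"
  shows "ereal D < val (laurent_eval f x - laurent_eval f y
           - (\<Sum>j\<in>UNIV. laurent_eval (laurent_pderiv j f) u * (x $ j - y $ j)))"
proof -
  have "ereal D < val (\<Sum>\<alpha>\<in>Poly_Mapping.keys f. Poly_Mapping.lookup f \<alpha> *
      (laurent_monom \<alpha> x - laurent_monom \<alpha> y
       - (\<Sum>j\<in>UNIV. of_int (\<alpha> $ j) * laurent_monom (\<alpha> - axis j 1) u * (x $ j - y $ j))))"
    by (intro val_sum_gt val_mult_gt int laurent_monom_expansion assms)
  also have "(\<Sum>\<alpha>\<in>Poly_Mapping.keys f. Poly_Mapping.lookup f \<alpha> *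
      (laurent_monom \<alpha> x - laurent_monom \<alpha> y
       - (\<Sum>j\<in>UNIV. of_int (\<alpha> $ j) * laurent_monom (\<alpha> - axis j 1) u * (x $ j - y $ j))))
    = laurent_eval f x - laurent_eval f y
      - (\<Sum>\<alpha>\<in>Poly_Mapping.keys f. \<Sum>j\<in>UNIV. of_int (\<alpha> $ j) * Poly_Mapping.lookup f \<alpha> *
           laurent_monom (\<alpha> - axis j 1) u * (x $ j - y $ j))"
    by (simp add: laurent_eval_monom right_diff_distrib[of "Poly_Mapping.lookup f _"]
        sum_subtractf sum_distrib_left mult.assoc mult.left_commute)
  also have "(\<Sum>\<alpha>\<in>Poly_Mapping.keys f. \<Sum>j\<in>UNIV. of_int (\<alpha> $ j) * Poly_Mapping.lookup f \<alpha> *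
        laurent_monom (\<alpha> - axis j 1) u * (x $ j - y $ j))
    = (\<Sum>j\<in>UNIV. laurent_eval (laurent_pderiv j f) u * (x $ j - y $ j))"
    by (subst sum.swap) (simp add: laurent_eval_pderiv sum_distrib_right)
  finally show ?thesis .
qed


section \<open>Hensel lifting\<close>

lemma matrix_vector_val_ge:
  fixes A :: "'a::valued_field ^ 'n ^ 'n"
  assumes "\<And>i j. 0 \<le> val (A $ i $ j)" "\<And>j. ereal D \<le> val (v $ j)"
  shows "ereal D \<le> val ((A *v v) $ i)"
  unfolding matrix_vector_mult_def using assms by (auto intro!: val_sum_ge val_mult_ge)

lemma matrix_vector_val_gt:
  fixes A :: "'a::valued_field ^ 'n ^ 'n"
  assumes "\<And>i j. 0 \<le> val (A $ i $ j)" "\<And>j. ereal D < val (v $ j)"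
  shows "ereal D < val ((A *v v) $ i)"
  unfolding matrix_vector_mult_def using assms by (auto intro!: val_sum_gt val_mult_gt)

lemma matrix_vector_val_gt':
  fixes A :: "'a::valued_field ^ 'n ^ 'n"
  assumes "\<And>i j. 0 < val (A $ i $ j)" "\<And>j. ereal D \<le> val (v $ j)"
  shows "ereal D < val ((A *v v) $ i)"
  unfolding matrix_vector_mult_def using assms by (auto intro!: val_sum_gt val_mult_gt')

lemma val_unbounded_imp_0:
  fixes x :: "'a::valued_field"
  assumes "0 < c" "\<And>k::nat. ereal (c * of_nat (Suc k)) \<le> val x"
  shows "x = 0"
proof (rule ccontr)
  assume x: "x \<noteq> 0"
  obtain k :: nat where "rval x / c < of_nat k"
    using reals_Archimedean2 by blast
  then have "rval x < c * of_nat (Suc k)"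
    using assms(1) by (simp add: field_simps)
  then show False
    using assms(2)[of k] x by (simp add: val_rval)
qed

text \<open>
  In the ultrametric setting a sequence whose increments tend to zero is Cauchy, and its limit is as
  close to each member as the increments from there on.
\<close>

lemma val_telescoping_limit:
  fixes X :: "nat \<Rightarrow> 'a::complete_discrete_valued_field"
  assumes c: "0 < c"
    and step: "\<And>k. ereal (c * of_nat (Suc k)) \<le> val (X (Suc k) - X k)"
  obtains L where "\<And>k. ereal (c * of_nat (Suc k)) \<le> val (L - X k)"
proof -
  have tail: "ereal (c * of_nat (Suc k)) \<le> val (X p - X k)" if "k \<le> p" for k p
    using that
  proof (induction p rule: dec_induct)
    case (step p)
    have "ereal (c * of_nat (Suc k)) \<le> ereal (c * of_nat (Suc p))"
      using step c by (simp add: mult_left_mono)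
    also have "\<dots> \<le> val (X (Suc p) - X p)"
      by (rule assms(2))
    finally show ?case
      using val_add_ge[OF _ step.IH, of "X (Suc p) - X p"] by simp
  qed simp
  have "\<exists>N. \<forall>p\<ge>N. \<forall>q\<ge>N. ereal C \<le> val (X p - X q)" for C
  proof -
    obtain N :: nat where "C / c < of_nat N"
      using reals_Archimedean2 by blast
    then have "ereal C \<le> ereal (c * of_nat (Suc N))"
      using c by (simp add: field_simps)
    then have "ereal C \<le> val (X p - X N)" if "N \<le> p" for p
      using tail[OF that] by (rule order_trans)
    then have "ereal C \<le> val (X p - X q)" if "N \<le> p" "N \<le> q" for p q
      using that val_diff_ge[of "ereal C" "X p - X N" "X q - X N"] by simp
    then show ?thesis
      by blast
  qed
  then obtain L where L: "\<And>C. \<exists>N. \<forall>p\<ge>N. ereal C \<le> val (X p - L)"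
    using val_complete[of X] by blast
  have "ereal (c * of_nat (Suc k)) \<le> val (L - X k)" for k
  proof -
    obtain N where "\<forall>p\<ge>N. ereal (c * of_nat (Suc k)) \<le> val (X p - L)"
      using L by blast
    then have "ereal (c * of_nat (Suc k)) \<le> val (X (max N k) - L)"
      by simp
    then show ?thesis
      using val_diff_ge[OF tail[of k "max N k"], of "X (max N k) - L"] by simp
  qed
  then show ?thesis
    using that by blast
qed

text \<open>
  Newton's method with a constant approximate inverse. On the residue class of \<open>u\<close> the function \<open>g\<close> is
  linear with matrix \<open>d\<close> up to higher order, and \<open>B\<close> inverts \<open>d\<close> modulo the maximal ideal. A step
  \<open>x - B *v g x\<close> leaves the value \<open>g x - d *v (B *v g x)\<close> up to higher order, which is itself of
  higher order than \<open>g x\<close>. So the values gain one unit of valuation in each step and the iterates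
  converge to a zero. For uniqueness, if \<open>y\<close> and \<open>y'\<close> are zeros, then \<open>d *v (y - y')\<close> is of higher
  order than \<open>y - y'\<close>, and multiplying by \<open>B\<close> shows the same for \<open>y - y'\<close>, which must therefore vanish.
\<close>

lemma multivariate_hensel:
  fixes \<pi> :: "'a::complete_discrete_valued_field"
    and g :: "'a ^ 'n \<Rightarrow> 'a ^ 'n" and d B :: "'a ^ 'n ^ 'n"
  assumes unif: "uniformizer \<pi>"
    and expansion: "\<And>D x y i. 0 < D \<Longrightarrow> (\<And>j. 0 < val ((y - u) $ j)) \<Longrightarrow>
        (\<And>j. ereal D \<le> val ((x - y) $ j)) \<Longrightarrow>
        ereal D < val ((g x - g y - d *v (x - y)) $ i)"
    and d: "\<And>i j. 0 \<le> val (d $ i $ j)" and B: "\<And>i j. 0 \<le> val (B $ i $ j)"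
    and dB: "\<And>i j. 0 < val ((d ** B - mat 1) $ i $ j)"
    and Bd: "\<And>i j. 0 < val ((B ** d - mat 1) $ i $ j)"
    and root: "\<And>i. 0 < val (g u $ i)"
  shows "\<exists>!x. (\<forall>j. 0 < val ((x - u) $ j)) \<and> g x = 0"
proof -
  have c: "0 < rval \<pi>"
    using unif by (rule uniformizer_rval_pos)
  \<comment> \<open>\<open>q k\<close> is the precision reached after \<open>k\<close> steps; it starts at \<open>rval \<pi>\<close>, not at \<open>0\<close>, because the
    expansion needs \<open>D > 0\<close>.\<close>
  define q where "q = (\<lambda>k::nat. rval \<pi> * of_nat (Suc k))"
  have q_pos: "0 < q k" for k
    using c by (simp add: q_def)
  have q_Suc: "ereal (q (Suc k)) \<le> val x" if "ereal (q k) < val x" for k and x :: 'a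
    using val_gt_multiple_imp_ge[OF unif, of "Suc k" x] that by (simp add: q_def)
  have q_0: "ereal (q 0) \<le> val x" if "0 < val x" for x :: 'a
    using val_gt_multiple_imp_ge[OF unif, of 0 x] that by (simp add: q_def zero_ereal_def)
  have pos: "0 < val x" if "ereal (q k) \<le> val x" for k and x :: 'a
    using that q_pos[of k] by (cases "val x") auto

  define N where "N = (\<lambda>x. x - B *v g x)"
  define X where "X = (\<lambda>k. (N ^^ k) u)"
  have X_Suc: "X (Suc k) - X k = - (B *v g (X k))" for k
    by (simp add: X_def N_def)
  have X: "(\<forall>j. 0 < val ((X k - u) $ j)) \<and> (\<forall>i. ereal (q k) \<le> val (g (X k) $ i))" for k
  proof (induction k)
    case 0
    then show ?case
      using q_0 root by (simp add: X_def)
  next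
    case (Suc k)
    let ?x = "X k" and ?y = "X (Suc k)"
    have Bg: "ereal (q k) \<le> val ((?y - ?x) $ j)" for j
      using matrix_vector_val_ge[OF B, of "q k" "g ?x"] Suc by (simp add: X_Suc)
    have "0 < val ((?y - u) $ j)" for j
      using val_add_gt[OF pos[OF Bg[of j]], of "(?x - u) $ j"] Suc by simp
    moreover have "ereal (q (Suc k)) \<le> val (g ?y $ i)" for i
    proof (rule q_Suc)
      have "ereal (q k) < val ((g ?y - g ?x - d *v (?y - ?x)) $ i)"
        using Suc Bg q_pos by (intro expansion) auto
      moreover have "ereal (q k) < val (((d ** B - mat 1) *v g ?x) $ i)"
        using Suc by (intro matrix_vector_val_gt' dB) auto
      moreover have "(g ?y - g ?x - d *v (?y - ?x)) - (d ** B - mat 1) *v g ?x = g ?y"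
        by (simp add: X_Suc matrix_vector_mult_diff_rdistrib matrix_vector_mul_assoc
            vector_matrix_mult_def vec.neg)
      ultimately show "ereal (q k) < val (g ?y $ i)"
        using val_diff_gt vector_minus_component by metis
    qed
    ultimately show ?case
      by blast
  qed
  have "\<exists>L. \<forall>k. ereal (q k) \<le> val (L - X k $ j)" for j
  proof -
    have "ereal (q k) \<le> val (X (Suc k) $ j - X k $ j)" for k
    proof -
      have "ereal (q k) \<le> val ((X (Suc k) - X k) $ j)"
        using matrix_vector_val_ge[OF B, of "q k" "g (X k)"] X by (simp add: X_Suc)
      then show ?thesis
        by simp
    qed
    then show ?thesis
      using val_telescoping_limit[OF c, of "\<lambda>k. X k $ j"] unfolding q_def by metis
  qed
  then obtain L where L: "\<And>j k. ereal (q k) \<le> val (L j - X k $ j)"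
    by metis
  define x where "x = (\<chi> j. L j)"
  have x: "ereal (q k) \<le> val ((x - X k) $ j)" for j k
    using L by (simp add: x_def)
  have "g x $ i = 0" for i
  proof (rule val_unbounded_imp_0[OF c])
    fix k
    have lin: "ereal (q k) < val ((g x - g (X k) - d *v (x - X k)) $ i)"
      using X x q_pos by (intro expansion) auto
    have "ereal (q k) \<le> val ((d *v (x - X k)) $ i)"
      using x by (intro matrix_vector_val_ge d) auto
    then have "ereal (q k) \<le> val ((g x - g (X k) - d *v (x - X k)) $ i + (d *v (x - X k)) $ i)"
      using lin by (intro val_add_ge) auto
    then have "ereal (q k) \<le> val (g x $ i - g (X k) $ i + g (X k) $ i)"
      using X[of k] by (intro val_add_ge) auto
    then show "ereal (rval \<pi> * of_nat (Suc k)) \<le> val (g x $ i)"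
      by (simp add: q_def)
  qed
  then have "g x = 0"
    by (simp add: vec_eq_iff)
  moreover have "0 < val ((x - u) $ j)" for j
    using pos[OF x[of 0 j]] by (simp add: X_def)
  moreover have "y = y'" if y: "\<forall>j. 0 < val ((y - u) $ j)" "g y = 0"
    and y': "\<forall>j. 0 < val ((y' - u) $ j)" "g y' = 0" for y y'
  proof -
    have "\<forall>j. ereal (q k) \<le> val ((y - y') $ j)" for k
    proof (induction k)
      case 0
      have "0 < val ((y - y') $ j)" for j
        using val_diff_gt[of 0 "(y - u) $ j" "(y' - u) $ j"] y y' by simp
      then show ?case
        using q_0 by blast
    next
      case (Suc k)
      have "ereal (q k) < val ((g y - g y' - d *v (y - y')) $ i)" for i
        using y' Suc q_pos by (intro expansion) auto
      then have "ereal (q k) < val ((d *v (y - y')) $ i)" for i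
        using y y' by simp
      then have "ereal (q k) < val ((B *v (d *v (y - y'))) $ j)" for j
        by (rule matrix_vector_val_gt[OF B])
      moreover have "ereal (q k) < val (((B ** d - mat 1) *v (y - y')) $ j)" for j
        using Suc by (intro matrix_vector_val_gt' Bd) auto
      moreover have "B *v (d *v (y - y')) - (B ** d - mat 1) *v (y - y') = y - y'"
        by (simp add: matrix_vector_mult_diff_rdistrib matrix_vector_mul_assoc)
      ultimately have "ereal (q k) < val ((y - y') $ j)" for j
        using val_diff_gt vector_minus_component by metis
      then show ?case
        using q_Suc by blast
    qed
    then have "(y - y') $ j = 0" for j
      using val_unbounded_imp_0[OF c] unfolding q_def by blast
    then show ?thesis
      by (simp add: vec_eq_iff)
  qed
  ultimately show ?thesis
    by blast
qed


section \<open>Lifting zeros of the reduction of an integral Laurent system\<close>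

definition reduction :: "('a::valued_field, 'n::finite) laurent \<Rightarrow> ('a residue, 'n) laurent"
  where "reduction f = Poly_Mapping.mapp (\<lambda>_. abs_residue) f"

lemma lookup_reduction:
  "Poly_Mapping.lookup (reduction f) \<alpha> = abs_residue (Poly_Mapping.lookup f \<alpha>)"
  by (auto simp: reduction_def lookup_mapp in_keys_iff zero_residue.abs_eq when_def)

lemma keys_reduction: "Poly_Mapping.keys (reduction f) \<subseteq> Poly_Mapping.keys f"
  unfolding reduction_def by (rule keys_mapp_subset)

text \<open>
  Reducing the coefficients commutes with evaluation and with partial derivatives, because the
  residue map is a ring homomorphism. Coefficients of positive valuation drop out, so the support may
  shrink. The next two lemmas therefore compare sums over the support of \<open>f\<close>.
\<close>

lemma laurent_eval_reduction:
  assumes "\<And>\<alpha>. 0 \<le> val (Poly_Mapping.lookup f \<alpha>)" "\<And>j. val (x $ j) = 0"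
  shows "laurent_eval (reduction f) (\<chi> j. abs_residue (x $ j)) = abs_residue (laurent_eval f x)"
  unfolding laurent_eval_superset[OF finite_keys keys_reduction]
  unfolding laurent_eval_monom
  by (simp add: abs_residue_sum abs_residue_mult abs_residue_laurent_monom lookup_reduction
      val_laurent_monom_unit val_mult_ge0 assms)

lemma laurent_eval_pderiv_reduction:
  assumes "\<And>\<alpha>. 0 \<le> val (Poly_Mapping.lookup f \<alpha>)" "\<And>j. val (x $ j) = 0"
  shows "laurent_eval (laurent_pderiv j (reduction f)) (\<chi> j. abs_residue (x $ j)) =
    abs_residue (laurent_eval (laurent_pderiv j f) x)"
  unfolding laurent_eval_pderiv_superset[OF finite_keys keys_reduction]
  unfolding laurent_eval_pderiv
  by (simp add: abs_residue_sum abs_residue_mult abs_residue_laurent_monom lookup_reduction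
      val_laurent_monom_unit val_mult_ge0 val_of_int abs_residue_of_int assms)

lemma val_laurent_eval_ge_0:
  assumes "\<And>\<alpha>. 0 \<le> val (Poly_Mapping.lookup f \<alpha>)" "\<And>j. val (x $ j) = 0"
  shows "0 \<le> val (laurent_eval f x)"
  unfolding laurent_eval_monom
  by (intro val_sum_ge_0) (simp add: val_mult_ge0 val_laurent_monom_unit assms)

lemma val_laurent_eval_pderiv_ge_0:
  assumes "\<And>\<alpha>. 0 \<le> val (Poly_Mapping.lookup f \<alpha>)" "\<And>j. val (x $ j) = 0"
  shows "0 \<le> val (laurent_eval (laurent_pderiv j f) x)"
  unfolding laurent_eval_pderiv
  by (intro val_sum_ge_0) (simp add: val_mult_ge0 val_laurent_monom_unit val_of_int assms)

text \<open>
  Lifts of mutually inverse matrices over the residue field are inverse to each other modulo the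
  maximal ideal; this provides the approximate inverse for Newton's method.
\<close>

lemma matrix_product_congruent_mat_1:
  fixes A B :: "'a::valued_field ^ 'n ^ 'n"
  assumes "\<And>i j. 0 \<le> val (A $ i $ j)" "\<And>i j. 0 \<le> val (B $ i $ j)"
    and "(\<chi> i j. abs_residue (A $ i $ j)) ** (\<chi> i j. abs_residue (B $ i $ j)) = mat 1"
  shows "0 < val ((A ** B - mat 1) $ i $ j)"
proof -
  have "0 \<le> val ((A ** B) $ i $ j)"
    unfolding matrix_matrix_mult_def
    by (simp add: val_sum_ge_0 val_mult_ge0 assms)
  moreover have "abs_residue ((A ** B) $ i $ j) = abs_residue (mat 1 $ i $ j)"
  proof -
    have "abs_residue ((A ** B) $ i $ j) =
        ((\<chi> i j. abs_residue (A $ i $ j)) ** (\<chi> i j. abs_residue (B $ i $ j))) $ i $ j"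
      unfolding matrix_matrix_mult_def
      by (simp add: abs_residue_sum abs_residue_mult val_mult_ge0 assms)
    then show ?thesis
      using assms(3) by (simp add: mat_def zero_residue.abs_eq one_residue.abs_eq)
  qed
  ultimately show ?thesis
    using abs_residue_eq_iff[of "(A ** B) $ i $ j" "mat 1 $ i $ j"] by (simp add: mat_def)
qed

text \<open>
  The residue class of any lift \<open>u\<close> of \<open>z\<close> consists exactly of the points that reduce to \<open>z\<close>. The
  Jacobian matrix at \<open>u\<close> is integral and reduces to the one at \<open>z\<close>, so a lift of the inverse of the
  latter makes the multivariate Hensel lemma applicable.
\<close>

lemma nondegenerate_zero_lifts_uniquely:
  fixes \<pi> :: "'a::complete_discrete_valued_field"
    and G :: "('a, 'n::finite) laurent ^ 'n"
  assumes unif: "uniformizer \<pi>"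
    and int: "\<And>i \<alpha>. 0 \<le> val (Poly_Mapping.lookup (G $ i) \<alpha>)"
    and z: "z \<in> torus_zeros (\<chi> i. reduction (G $ i))"
    and nondeg: "det (jacobian_matrix (\<chi> i. reduction (G $ i)) z) \<noteq> 0"
  shows "\<exists>!x. (\<forall>j. val (x $ j) = 0 \<and> abs_residue (x $ j) = z $ j) \<and> (\<forall>i. laurent_eval (G $ i) x = 0)"
proof -
  have "\<exists>a::'a. 0 \<le> val a \<and> z $ j = abs_residue a" for j
    using abs_residue_cases by metis
  then obtain a :: "'n \<Rightarrow> 'a" where a: "\<And>j. 0 \<le> val (a j)" "\<And>j. z $ j = abs_residue (a j)"
    by metis
  define u where "u = (\<chi> j. a j)"
  have z_eq: "z = (\<chi> j. abs_residue (u $ j))"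
    by (simp add: u_def vec_eq_iff a)
  have u: "val (u $ j) = 0" for j
  proof -
    have "z $ j \<noteq> 0"
      using z by (simp add: torus_zeros_def)
    then show ?thesis
      using a[of j] by (simp add: u_def abs_residue_eq_0_iff)
  qed
  have fibre: "(val (x $ j) = 0 \<and> abs_residue (x $ j) = z $ j) \<longleftrightarrow> 0 < val ((x - u) $ j)"
    for x :: "'a ^ 'n" and j
    using val_eq_0_if_close[of "x $ j" "u $ j"] u[of j] abs_residue_eq_iff[of "x $ j" "u $ j"]
    by (auto simp: z_eq)

  define g where "g = (\<lambda>x. \<chi> i. laurent_eval (G $ i) x)"
  have g_zero: "g x = 0 \<longleftrightarrow> (\<forall>i. laurent_eval (G $ i) x = 0)" for x
    by (simp add: g_def vec_eq_iff)
  define d where "d = jacobian_matrix G u"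
  have d: "0 \<le> val (d $ i $ j)" for i j
    using u int by (simp add: d_def jacobian_matrix_def val_laurent_eval_pderiv_ge_0)
  have d_red: "jacobian_matrix (\<chi> i. reduction (G $ i)) z = (\<chi> i j. abs_residue (d $ i $ j))"
    using u int by (simp add: d_def jacobian_matrix_def z_eq laurent_eval_pderiv_reduction)
  obtain B' where B': "(\<chi> i j. abs_residue (d $ i $ j)) ** B' = mat 1"
      "B' ** (\<chi> i j. abs_residue (d $ i $ j)) = mat 1"
    using nondeg unfolding d_red by (auto simp: invertible_def simp flip: invertible_det_nz)
  have "\<exists>b::'a. 0 \<le> val b \<and> B' $ i $ j = abs_residue b" for i j
    using abs_residue_cases by metis
  then obtain b :: "'n \<Rightarrow> 'n \<Rightarrow> 'a"
    where b: "\<And>i j. 0 \<le> val (b i j)" "\<And>i j. B' $ i $ j = abs_residue (b i j)"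
    by metis
  define B where "B = (\<chi> i j. b i j)"
  have B: "0 \<le> val (B $ i $ j)" for i j
    by (simp add: B_def b)
  have B'_eq: "B' = (\<chi> i j. abs_residue (B $ i $ j))"
    by (simp add: B_def vec_eq_iff b)

  have "\<exists>!x. (\<forall>j. 0 < val ((x - u) $ j)) \<and> g x = 0"
  proof (rule multivariate_hensel[OF unif _ d B])
    show "ereal D < val ((g x - g y - d *v (x - y)) $ i)"
      if "0 < D" "\<And>j. 0 < val ((y - u) $ j)" "\<And>j. ereal D \<le> val ((x - y) $ j)" for D x y i
      using laurent_eval_expansion[of D "G $ i" u y x] that u int
      by (simp add: g_def d_def matrix_vector_mult_def jacobian_matrix_def)
    show "0 < val ((d ** B - mat 1) $ i $ j)" "0 < val ((B ** d - mat 1) $ i $ j)" for i j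
      by (rule matrix_product_congruent_mat_1[OF d B B'(1)[unfolded B'_eq]]
          matrix_product_congruent_mat_1[OF B d B'(2)[unfolded B'_eq]])+
    show "0 < val (g u $ i)" for i
      using z int u
      by (auto simp: g_def torus_zeros_def z_eq laurent_eval_reduction abs_residue_eq_0_iff
          val_laurent_eval_ge_0)
  qed
  then show ?thesis
    unfolding fibre g_zero .
qed


section \<open>Rescaling to valuation zero\<close>

text \<open>
  The polynomial \<open>\<pi>\<^sup>-\<^sup>T f(\<pi>\<^sup>m u)\<close> in the variables \<open>u\<close>: the substitution multiplies the coefficient at \<open>\<alpha>\<close>
  by the power of \<open>\<pi>\<close> with exponent \<open>\<alpha> \<cdot> m\<close>.
\<close>

definition rescale ::
    "'a::field \<Rightarrow> ('n \<Rightarrow> int) \<Rightarrow> int \<Rightarrow> ('a, 'n::finite) laurent \<Rightarrow> ('a, 'n) laurent"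
  where "rescale \<pi> m T f =
    Poly_Mapping.mapp (\<lambda>\<alpha> a. \<pi> powi ((\<Sum>j\<in>UNIV. \<alpha> $ j * m j) - T) * a) f"

lemma lookup_rescale:
  "Poly_Mapping.lookup (rescale \<pi> m T f) \<alpha> =
    \<pi> powi ((\<Sum>j\<in>UNIV. \<alpha> $ j * m j) - T) * Poly_Mapping.lookup f \<alpha>"
  by (auto simp: rescale_def lookup_mapp in_keys_iff when_def)

lemma keys_rescale: "Poly_Mapping.keys (rescale \<pi> m T f) \<subseteq> Poly_Mapping.keys f"
  unfolding rescale_def by (rule keys_mapp_subset)

lemma laurent_eval_rescale:
  assumes "\<pi> \<noteq> 0"
  shows "laurent_eval f (\<chi> j. \<pi> powi m j * u $ j) = \<pi> powi T * laurent_eval (rescale \<pi> m T f) u"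
proof -
  have "laurent_monom \<alpha> (\<chi> j. \<pi> powi m j * u $ j) =
      \<pi> powi T * (\<pi> powi ((\<Sum>j\<in>UNIV. \<alpha> $ j * m j) - T) * laurent_monom \<alpha> u)" for \<alpha>
    using laurent_monom_mult[of \<alpha> "\<chi> j. \<pi> powi m j" u] laurent_monom_powi[OF assms, of \<alpha> m] assms
    by (simp add: power_int_diff)
  then show ?thesis
    unfolding laurent_eval_superset[OF finite_keys keys_rescale] laurent_eval_monom[of f]
    by (simp add: sum_distrib_left lookup_rescale mult_ac)
qed

text \<open>
  With \<open>T\<close> such that \<open>tr f w\<close> is \<open>T\<close> times the valuation of \<open>\<pi>\<close>, the rescaled coefficient at \<open>\<alpha>\<close> has
  valuation \<open>trop_term f \<alpha> w - tr f w\<close>. It is integral, it is a unit exactly when the minimum is attained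
  at \<open>\<alpha>\<close>, and its residue is then the first digit of the original coefficient.
\<close>

lemma initial_form_eq_reduction:
  fixes \<pi> :: "'a::complete_discrete_valued_field" and f :: "('a, 'n::finite) laurent"
  assumes unif: "uniformizer \<pi>" and f: "f \<noteq> 0"
    and w: "\<And>j. w $ j = rval \<pi> * of_int (m j)"
  obtains T where "\<And>\<alpha>. 0 \<le> val (Poly_Mapping.lookup (rescale \<pi> m T f) \<alpha>)"
    and "initial_form \<pi> w f = reduction (rescale \<pi> m T f)"
proof -
  have nz: "\<pi> \<noteq> 0" and c: "0 < rval \<pi>"
    using unif by (rule uniformizer_neq_0 uniformizer_rval_pos)+
  let ?a = "Poly_Mapping.lookup f"
  define e where "e = (\<lambda>\<alpha>. \<lfloor>rval (?a \<alpha>) / rval \<pi>\<rfloor>)"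
  define l where "l = (\<lambda>\<alpha>. e \<alpha> + (\<Sum>j\<in>UNIV. \<alpha> $ j * m j))"
  have e: "rval (?a \<alpha>) = rval \<pi> * of_int (e \<alpha>)" if "\<alpha> \<in> Poly_Mapping.keys f" for \<alpha>
  proof -
    have "?a \<alpha> \<noteq> 0"
      using that by (simp add: in_keys_iff)
    then obtain k :: int where "rval (?a \<alpha>) = rval \<pi> * of_int k"
      using rval_multiple_of_uniformizer[OF unif] by metis
    then show ?thesis
      using c by (simp add: e_def)
  qed
  have term_eq: "trop_term f \<alpha> w = rval \<pi> * of_int (l \<alpha>)" if "\<alpha> \<in> Poly_Mapping.keys f" for \<alpha>
    using e[OF that]
    by (simp add: trop_term_def l_def inner_vec_def w sum_distrib_left distrib_left mult_ac)
  have "tr f w \<in> (\<lambda>\<alpha>. trop_term f \<alpha> w) ` Poly_Mapping.keys f"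
    unfolding tr_def using f by (intro Min_in) auto
  then obtain \<alpha>0 where \<alpha>0: "\<alpha>0 \<in> Poly_Mapping.keys f" "tr f w = trop_term f \<alpha>0 w"
    by auto
  have tr_le: "tr f w \<le> trop_term f \<alpha> w" if "\<alpha> \<in> Poly_Mapping.keys f" for \<alpha>
    unfolding tr_def using that by simp
  define T where "T = l \<alpha>0"
  have T_le: "T \<le> l \<alpha>" and T_eq: "trop_term f \<alpha> w = tr f w \<longleftrightarrow> l \<alpha> = T"
    if "\<alpha> \<in> Poly_Mapping.keys f" for \<alpha>
    using tr_le[OF that] term_eq[OF that] term_eq[OF \<alpha>0(1)] \<alpha>0(2) c by (simp_all add: T_def)
  have val_eq: "val (Poly_Mapping.lookup (rescale \<pi> m T f) \<alpha>) = ereal (rval \<pi> * of_int (l \<alpha> - T))"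
    if "\<alpha> \<in> Poly_Mapping.keys f" for \<alpha>
  proof -
    have "val (?a \<alpha>) = ereal (rval \<pi> * of_int (e \<alpha>))"
      using that e by (simp add: in_keys_iff val_rval)
    then show ?thesis
      using val_powi[OF val_rval[OF nz]]
      by (simp add: lookup_rescale val_mult l_def algebra_simps)
  qed
  have "initial_form \<pi> w f = reduction (rescale \<pi> m T f)"
  proof (rule poly_mapping_eqI)
    fix \<beta>
    have "Poly_Mapping.lookup (initial_form \<pi> w f) \<beta> =
        (if \<beta> \<in> Poly_Mapping.keys f \<and> l \<beta> = T then first_digit \<pi> (?a \<beta>) else 0)"
      using T_eq
      by (auto simp: initial_form_def lookup_sum lookup_single when_def sum.If_cases)
    also have "\<dots> = abs_residue (Poly_Mapping.lookup (rescale \<pi> m T f) \<beta>)"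
    proof (cases "\<beta> \<in> Poly_Mapping.keys f")
      case True
      show ?thesis
      proof (cases "l \<beta> = T")
        case eq: True
        then have "(\<Sum>j\<in>UNIV. \<beta> $ j * m j) - T = - e \<beta>"
          by (simp add: l_def)
        then show ?thesis
          using eq \<open>\<beta> \<in> _\<close> by (simp add: first_digit_def lookup_rescale e_def)
      next
        case False
        then have "0 < val (Poly_Mapping.lookup (rescale \<pi> m T f) \<beta>)"
          using T_le[OF True] val_eq[OF True] c by simp
        then show ?thesis
          using False abs_residue_eq_0_iff[of "Poly_Mapping.lookup (rescale \<pi> m T f) \<beta>"] by simp
      qed
    qed (simp add: lookup_rescale in_keys_iff zero_residue.abs_eq)
    finally show "Poly_Mapping.lookup (initial_form \<pi> w f) \<beta> =
        Poly_Mapping.lookup (reduction (rescale \<pi> m T f)) \<beta>"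
      by (simp add: lookup_reduction)
  qed
  moreover have "0 \<le> val (Poly_Mapping.lookup (rescale \<pi> m T f) \<alpha>)" for \<alpha>
  proof (cases "\<alpha> \<in> Poly_Mapping.keys f")
    case True
    then show ?thesis
      using T_le[OF True] val_eq[OF True] c by simp
  qed (simp add: lookup_rescale in_keys_iff)
  ultimately show ?thesis
    using that by blast
qed

theorem theorem1p2:
  fixes \<pi> :: "'a::complete_discrete_valued_field"
    and F :: "('a, 'n::finite) laurent ^ 'n"
    and w :: "real ^ 'n"
  assumes "uniformizer \<pi>"
    and "\<And>i. F $ i \<noteq> 0"
    and "\<And>j. \<exists>m::int. w $ j = rval \<pi> * of_int m"
    and "w isolated_in Trop_system F"
    and "\<not> (\<exists>z. degenerate_zero (initial_system \<pi> w F) z)"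
  shows "bij_betw (\<lambda>x. \<chi> j. first_digit \<pi> (x $ j))
           {x \<in> torus_zeros F. \<forall>j. val (x $ j) = ereal (w $ j)}
           (torus_zeros (initial_system \<pi> w F))"
proof -
  note unif = assms(1)
  have nz: "\<pi> \<noteq> 0" and c: "0 < rval \<pi>"
    using unif by (rule uniformizer_neq_0 uniformizer_rval_pos)+
  obtain m :: "'n \<Rightarrow> int" where m: "\<And>j. w $ j = rval \<pi> * of_int (m j)"
    using assms(3) by metis
  have "\<exists>T. (\<forall>\<alpha>. 0 \<le> val (Poly_Mapping.lookup (rescale \<pi> m T (F $ i)) \<alpha>)) \<and>
      initial_form \<pi> w (F $ i) = reduction (rescale \<pi> m T (F $ i))" for i
    using initial_form_eq_reduction[OF unif assms(2) m] by metis
  then obtain T where T: "\<And>i \<alpha>. 0 \<le> val (Poly_Mapping.lookup (rescale \<pi> m (T i) (F $ i)) \<alpha>)"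
      "\<And>i. initial_form \<pi> w (F $ i) = reduction (rescale \<pi> m (T i) (F $ i))"
    by metis
  define G where "G = (\<chi> i. rescale \<pi> m (T i) (F $ i))"
  have int: "0 \<le> val (Poly_Mapping.lookup (G $ i) \<alpha>)" for i \<alpha>
    by (simp add: G_def T)
  have initial: "initial_system \<pi> w F = (\<chi> i. reduction (G $ i))"
    by (simp add: initial_system_def G_def T)

  \<comment> \<open>\<open>scale\<close> identifies the unit zeros of \<open>G\<close> with the zeros of \<open>F\<close> of valuation \<open>w\<close>, and turns the first
    digit into the residue.\<close>
  define scale where "scale = (\<lambda>u::'a^'n. \<chi> j. \<pi> powi m j * u $ j)"
  have scale_zero: "laurent_eval (F $ i) (scale u) = 0 \<longleftrightarrow> laurent_eval (G $ i) u = 0" for i u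
    using laurent_eval_rescale[OF nz, of "F $ i" m u "T i"] nz by (simp add: scale_def G_def)
  have scale_val: "val (scale u $ j) = ereal (w $ j) \<longleftrightarrow> val (u $ j) = 0" for u j
    using val_powi[OF val_rval[OF nz], of "m j"]
    by (cases "val (u $ j)") (auto simp: scale_def val_mult m mult.commute zero_ereal_def)
  have digit: "first_digit \<pi> (scale u $ j) = abs_residue (u $ j)" if "val (u $ j) = 0" for u j
  proof -
    have "rval (scale u $ j) = rval \<pi> * of_int (m j)"
      using scale_val[of u j] that m by (simp add: rval_def)
    then show ?thesis
      using c nz by (simp add: first_digit_def scale_def power_int_minus flip: mult.assoc)
  qed
  have scale_inj: "scale u = scale u' \<longleftrightarrow> u = u'" for u u'
    using nz by (simp add: scale_def vec_eq_iff)
  have scale_surj: "\<exists>u. x = scale u" for x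
    using nz by (intro exI[of _ "\<chi> j. x $ j / \<pi> powi m j"]) (simp add: scale_def vec_eq_iff)

  let ?U = "{u. (\<forall>j. val (u $ j) = 0) \<and> (\<forall>i. laurent_eval (G $ i) u = 0)}"
  let ?S = "{x \<in> torus_zeros F. \<forall>j. val (x $ j) = ereal (w $ j)}"
  let ?Z = "torus_zeros (\<chi> i. reduction (G $ i))"
  let ?\<rho> = "\<lambda>u::'a^'n. \<chi> j. abs_residue (u $ j)"
  have S_iff: "scale u \<in> ?S \<longleftrightarrow> u \<in> ?U" for u
  proof -
    have "scale u $ j \<noteq> 0" if "val (u $ j) = 0" for j
      using that nz by (auto simp: scale_def)
    then show ?thesis
      by (auto simp: torus_zeros_def scale_zero scale_val)
  qed
  have "bij_betw scale ?U ?S"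
  proof (rule bij_betwI')
    show "\<exists>u\<in>?U. x = scale u" if "x \<in> ?S" for x
      using that scale_surj[of x] S_iff by blast
  qed (use S_iff scale_inj in blast)+
  moreover have "bij_betw ?\<rho> ?U ?Z"
  proof -
    have into: "?\<rho> u \<in> ?Z" if "u \<in> ?U" for u
    proof -
      have u: "val (u $ j) = 0" "laurent_eval (G $ i) u = 0" for i j
        using that by auto
      then have "laurent_eval (reduction (G $ i)) (?\<rho> u) = 0" for i
        using int by (simp add: laurent_eval_reduction zero_residue.abs_eq)
      moreover have "abs_residue (u $ j) \<noteq> 0" for j
        using u by (simp add: abs_residue_eq_0_iff)
      ultimately show ?thesis
        by (simp add: torus_zeros_def)
    qed
    have lift: "\<exists>!u. u \<in> ?U \<and> ?\<rho> u = z" if "z \<in> ?Z" for z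
    proof -
      have "det (jacobian_matrix (\<chi> i. reduction (G $ i)) z) \<noteq> 0"
        using that assms(5) by (auto simp: degenerate_zero_def initial)
      from nondegenerate_zero_lifts_uniquely[OF unif int that this] show ?thesis
        by (simp add: vec_eq_iff all_conj_distrib conj_ac)
    qed
    have "inj_on ?\<rho> ?U"
    proof (rule inj_onI)
      fix u u' assume "u \<in> ?U" "u' \<in> ?U" "?\<rho> u = ?\<rho> u'"
      then show "u = u'"
        using lift[OF into[of u']] by blast
    qed
    moreover have "z \<in> ?\<rho> ` ?U" if "z \<in> ?Z" for z
      using lift[OF that] by blast
    ultimately show ?thesis
      unfolding bij_betw_def using into by blast
  qed
  moreover have "((\<lambda>x. \<chi> j. first_digit \<pi> (x $ j)) \<circ> scale) u = ?\<rho> u" if "u \<in> ?U" for u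
    using that digit by (simp add: vec_eq_iff)
  ultimately show ?thesis
    unfolding initial using bij_betw_comp_iff bij_betw_cong by (metis (no_types, lifting))
qed

end
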